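(* Let $X$ be a metrizable, separable, locally compact space and let $\mathcal F=\{f_1,\dots,f_m\}$ be an iterated function system on $X$. Assume that $\mathcal F$ has a compact global trapping region $Q\subset X$. Then $\mathcal F$ has compact dynamics, and its global attractor is $\mathcal G_{\mathcal F}=\Omega_{\mathcal F}(Q)$.
   Context: Fix a metric $d$ on $X$ compatible with its topology. An iterated function system (IFS) on $X$ is a finite collection $\mathcal F=\{f_1,\dots,f_m\}$, $m\ge1$, of continuous maps $X\to X$. $\mathcal I^m$ is the set of all finite words in the letters $1,\dots,m$ (including the empty word $0$); $|I|$ is the length of $I$. For $I=i_1\cdots i_k$, $\Phi^I_{\mathcal F}=f_{i_k}\circ\dots\circ f_{i_1}$, and $\Phi^0_{\mathcal F}=\mathrm{id}_X$. For $A\subset X$, $H_{\mathcal F}(A)=\bigcup_{i=1}^m f_i(A)$. $A$ is forward-invariant if $f_i(A)\subset A$ for every $i$, and $H$-invariant if $H_{\mathcal F}(A)=A$. $\Omega_{\mathcal F}(A)$ is the set of $y\in X$ for which there are $I_n\in\mathcal I^m$ and $a_n\in A$ with $|I_n|\to\infty$ and $\Phi^{I_n}_{\mathcal F}(a_n)\to y$. A set $A$ absorbs $K$ if there is $\tau>0$ with $\Phi^I_{\mathcal F}(K)\subset A$ for every $I$ with $|I|\ge\tau$. Put $N_\varepsilon(A)=\{x: d(x,A)<\varepsilon\}$, where $d(x,A)=\inf_{a\in A}d(x,a)$ and $\inf\emptyset=+\infty$. $A$ attracts $K$ if for every $\varepsilon>0$ there is $\tau>0$ with $\Phi^I_{\mathcal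 F}(K)\subset N_\varepsilon(A)$ for every $I$ with $|I|\ge\tau$. A global attractor of $\mathcal F$ is a compact $H$-invariant set that attracts every compact subset of $X$; it is unique if it exists, and is denoted $\mathcal G_{\mathcal F}$. $\mathcal F$ has compact dynamics if it has a global attractor. A trapping region is a closed forward-invariant set $Q\subset X$; it is global if it absorbs every compact subset of $X$. *)

theory Defs
  imports "HOL-Analysis.Analysis"
begin

text \<open>
  The space \<open>X\<close> is the universe of a type of class \<^class>\<open>metric_space\<close>, whose metric
  \<^const>\<open>dist\<close> is the fixed compatible metric. An iterated function system
  \<open>{f\<^sub>1, \<dots>, f\<^sub>m}\<close> is given by \<open>m\<close> and an indexed family \<open>f\<close>; the values
  \<open>f i\<close> with \<open>i\<close> outside \<open>{1..m}\<close> are irrelevant.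
\<close>

definition ifs :: "nat \<Rightarrow> (nat \<Rightarrow> 'a::metric_space \<Rightarrow> 'a) \<Rightarrow> bool" where
  "ifs m f \<longleftrightarrow> 1 \<le> m \<and> (\<forall>i\<in>{1..m}. continuous_on UNIV (f i))"

definition ifs_words :: "nat \<Rightarrow> nat list set" where
  "ifs_words m = lists {1..m}"

text \<open>The first letter of the word is applied first: \<open>fold f [i, j] = f j \<circ> f i\<close>.\<close>

definition Phi :: "(nat \<Rightarrow> 'a \<Rightarrow> 'a) \<Rightarrow> nat list \<Rightarrow> 'a \<Rightarrow> 'a" where
  "Phi f I = fold f I"

definition Hutch :: "nat \<Rightarrow> (nat \<Rightarrow> 'a \<Rightarrow> 'a) \<Rightarrow> 'a set \<Rightarrow> 'a set" where
  "Hutch m f A = (\<Union>i\<in>{1..m}. f i ` A)"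

definition forward_invariant :: "nat \<Rightarrow> (nat \<Rightarrow> 'a \<Rightarrow> 'a) \<Rightarrow> 'a set \<Rightarrow> bool" where
  "forward_invariant m f A \<longleftrightarrow> (\<forall>i\<in>{1..m}. f i ` A \<subseteq> A)"

definition H_invariant :: "nat \<Rightarrow> (nat \<Rightarrow> 'a \<Rightarrow> 'a) \<Rightarrow> 'a set \<Rightarrow> bool" where
  "H_invariant m f A \<longleftrightarrow> Hutch m f A = A"

definition Omega :: "nat \<Rightarrow> (nat \<Rightarrow> 'a::metric_space \<Rightarrow> 'a) \<Rightarrow> 'a set \<Rightarrow> 'a set" where
  "Omega m f A =
    {y. \<exists>(I :: nat \<Rightarrow> nat list) (a :: nat \<Rightarrow> 'a).
          (\<forall>n. I n \<in> ifs_words m) \<and> (\<forall>n. a n \<in> A) \<and>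
          filterlim (\<lambda>n. length (I n)) at_top sequentially \<and>
          (\<lambda>n. Phi f (I n) (a n)) \<longlonglongrightarrow> y}"

definition absorbs :: "nat \<Rightarrow> (nat \<Rightarrow> 'a \<Rightarrow> 'a) \<Rightarrow> 'a set \<Rightarrow> 'a set \<Rightarrow> bool" where
  "absorbs m f A K \<longleftrightarrow>
    (\<exists>\<tau>::nat>0. \<forall>I\<in>ifs_words m. \<tau> \<le> length I \<longrightarrow> Phi f I ` K \<subseteq> A)"

text \<open>
  The convention \<open>inf \<emptyset> = \<infinity>\<close> makes every neighbourhood of the empty set empty, whereas
  \<^const>\<open>infdist\<close> to the empty set is \<open>0\<close>; hence the explicit nonemptiness condition.
\<close>

definition eps_nbhd :: "real \<Rightarrow> 'a::metric_space set \<Rightarrow> 'a set" where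
  "eps_nbhd \<epsilon> A = {x. A \<noteq> {} \<and> infdist x A < \<epsilon>}"

definition attracts :: "nat \<Rightarrow> (nat \<Rightarrow> 'a::metric_space \<Rightarrow> 'a) \<Rightarrow> 'a set \<Rightarrow> 'a set \<Rightarrow> bool" where
  "attracts m f A K \<longleftrightarrow>
    (\<forall>\<epsilon>>0. \<exists>\<tau>::nat>0. \<forall>I\<in>ifs_words m. \<tau> \<le> length I \<longrightarrow> Phi f I ` K \<subseteq> eps_nbhd \<epsilon> A)"

definition is_global_attractor :: "nat \<Rightarrow> (nat \<Rightarrow> 'a::metric_space \<Rightarrow> 'a) \<Rightarrow> 'a set \<Rightarrow> bool" where
  "is_global_attractor m f G \<longleftrightarrow>
    compact G \<and> H_invariant m f G \<and> (\<forall>K. compact K \<longrightarrow> attracts m f G K)"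

definition compact_dynamics :: "nat \<Rightarrow> (nat \<Rightarrow> 'a::metric_space \<Rightarrow> 'a) \<Rightarrow> bool" where
  "compact_dynamics m f \<longleftrightarrow> (\<exists>G. is_global_attractor m f G)"

definition global_attractor :: "nat \<Rightarrow> (nat \<Rightarrow> 'a::metric_space \<Rightarrow> 'a) \<Rightarrow> 'a set" where
  "global_attractor m f = (THE G. is_global_attractor m f G)"

definition trapping_region :: "nat \<Rightarrow> (nat \<Rightarrow> 'a::metric_space \<Rightarrow> 'a) \<Rightarrow> 'a set \<Rightarrow> bool" where
  "trapping_region m f Q \<longleftrightarrow> closed Q \<and> forward_invariant m f Q"

definition global_trapping_region :: "nat \<Rightarrow> (nat \<Rightarrow> 'a::metric_space \<Rightarrow> 'a) \<Rightarrow> 'a set \<Rightarrow> bool" where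
  "global_trapping_region m f Q \<longleftrightarrow>
    trapping_region m f Q \<and> (\<forall>K. compact K \<longrightarrow> absorbs m f Q K)"

text \<open>Global attractors are unique, so \<^const>\<open>global_attractor\<close> is well defined.\<close>

lemma H_invariant_preimage:
  assumes "H_invariant m f G" "y \<in> G"
  shows "\<exists>I\<in>ifs_words m. length I = n \<and> y \<in> Phi f I ` G"
  using assms(2)
proof (induction n arbitrary: y)
  case 0
  then show ?case
    by (intro bexI[of _ "[]"]) (auto simp: Phi_def ifs_words_def)
next
  case (Suc n)
  have "y \<in> Hutch m f G"
    using assms(1) Suc.prems by (simp add: H_invariant_def)
  then obtain i x where i: "i \<in> {1..m}" "x \<in> G" "y = f i x"
    by (auto simp: Hutch_def)
  from Suc.IH[OF i(2)] obtain I where "I \<in> ifs_words m" "length I = n" "x \<in> Phi f I ` G"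
    by blast
  with i show ?case
    by (intro bexI[of _ "I @ [i]"]) (auto simp: Phi_def ifs_words_def simp del: atLeastAtMost_iff)
qed

lemma global_attractor_subset:
  assumes "is_global_attractor m f G" "is_global_attractor m f G'"
  shows "G \<subseteq> G'"
proof
  fix y assume y: "y \<in> G"
  have near: "G' \<noteq> {} \<and> infdist y G' < \<epsilon>" if \<epsilon>: "\<epsilon> > 0" for \<epsilon>
  proof -
    have "attracts m f G' G"
      using assms by (auto simp: is_global_attractor_def)
    then obtain \<tau> :: nat
      where \<tau>: "\<And>I. I \<in> ifs_words m \<Longrightarrow> \<tau> \<le> length I \<Longrightarrow> Phi f I ` G \<subseteq> eps_nbhd \<epsilon> G'"
      using \<epsilon> unfolding attracts_def by meson
    have "H_invariant m f G"
      using assms by (simp add: is_global_attractor_def)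
    from H_invariant_preimage[OF this y, of \<tau>] obtain I
      where "I \<in> ifs_words m" "length I = \<tau>" "y \<in> Phi f I ` G"
      by blast
    with \<tau>[of I] show ?thesis
      unfolding eps_nbhd_def by blast
  qed
  have "infdist y G' \<le> 0"
    using near by (metis less_irrefl not_le)
  then have "infdist y G' = 0"
    using infdist_nonneg[of y G'] by linarith
  moreover have "closed G'" "G' \<noteq> {}"
    using assms(2) near[of 1] by (auto simp: is_global_attractor_def compact_imp_closed)
  ultimately show "y \<in> G'"
    by (simp add: in_closed_iff_infdist_zero)
qed

lemma global_attractor_unique:
  assumes "is_global_attractor m f G" "is_global_attractor m f G'"
  shows "G = G'"
  using assms by (intro equalityI global_attractor_subset)

lemma global_attractor_eqI:
  assumes "is_global_attractor m f G"
  shows "global_attractor m f = G"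
  unfolding global_attractor_def
  using assms global_attractor_unique by (intro the_equality) auto

end

theory Submission
  imports Defs
begin

text \<open>
  The iterates \<open>H\<^sup>n(Q)\<close> of the Hutchinson operator form a decreasing sequence of compact
  sets, and \<open>\<Omega>(Q)\<close> is their intersection. Compactness and forward invariance of \<open>\<Omega>(Q)\<close> are then
  immediate. The inclusion \<open>\<Omega>(Q) \<subseteq> H(\<Omega>(Q))\<close> and the attraction of \<open>Q\<close> both follow from Cantor's
  intersection theorem, applied to the points of \<open>H\<^sup>n(Q)\<close> with a given image, and to the points of
  \<open>H\<^sup>n(Q)\<close> outside \<open>N\<^sub>\<epsilon>(\<Omega>(Q))\<close>. A compact set enters \<open>Q\<close> in bounded time, so it is
  attracted as well.
\<close>

lemma Phi_append: "Phi f (I @ J) x = Phi f J (Phi f I x)"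
  by (simp add: Phi_def)

lemma Hutch_mono: "A \<subseteq> B \<Longrightarrow> Hutch m f A \<subseteq> Hutch m f B"
  by (auto simp: Hutch_def)

lemma ifs_continuous_on: "ifs m f \<Longrightarrow> i \<in> {1..m} \<Longrightarrow> continuous_on A (f i)"
  unfolding ifs_def by (blast intro: continuous_on_subset)

lemma compact_Hutch:
  assumes "ifs m f" "compact A"
  shows "compact (Hutch m f A)"
  unfolding Hutch_def using assms
  by (intro compact_UN compact_continuous_image ifs_continuous_on) auto

lemma compact_Hutch_iterate:
  assumes "ifs m f" "compact A"
  shows "compact ((Hutch m f ^^ n) A)"
  by (induction n) (use assms compact_Hutch in auto)

text \<open>Forward invariance is the first inclusion of the chain, and monotonicity of
  \<open>Hutch\<close> carries it on to every later one.\<close>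

lemma decseq_Hutch_iterate:
  assumes "forward_invariant m f A"
  shows "decseq (\<lambda>n. (Hutch m f ^^ n) A)"
proof (rule decseq_SucI)
  fix n
  show "(Hutch m f ^^ Suc n) A \<subseteq> (Hutch m f ^^ n) A"
  proof (induction n)
    case 0
    then show ?case
      using assms by (auto simp: Hutch_def forward_invariant_def)
  next
    case (Suc n)
    then show ?case
      using Hutch_mono[OF Suc.IH] by simp
  qed
qed

text \<open>Bridge from words to iterates. \<open>Phi\<close> applies the last letter last, so
  splitting \<open>J\<close> as \<open>I @ [i]\<close> matches the outermost
  \<open>Hutch\<close>.\<close>

lemma Hutch_iterate_eq:
  "(Hutch m f ^^ n) A = (\<Union>I\<in>{I\<in>ifs_words m. length I = n}. Phi f I ` A)"
proof (induction n)
  case 0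
  then show ?case
    by (auto simp: ifs_words_def Phi_def)
next
  case (Suc n)
  have "(Hutch m f ^^ Suc n) A = (\<Union>i\<in>{1..m}. \<Union>I\<in>{I\<in>ifs_words m. length I = n}. Phi f (I @ [i]) ` A)"
    by (auto simp: Hutch_def Suc Phi_def image_image)
  also have "\<dots> = (\<Union>J\<in>{J\<in>ifs_words m. length J = Suc n}. Phi f J ` A)"
  proof (intro equalityI subsetI)
    fix y assume "y \<in> (\<Union>J\<in>{J\<in>ifs_words m. length J = Suc n}. Phi f J ` A)"
    then obtain J where J: "J \<in> ifs_words m" "length J = Suc n" "y \<in> Phi f J ` A"
      by blast
    obtain I i where "J = I @ [i]"
      using J(2) by (metis length_Suc_conv_rev)
    with J show "y \<in> (\<Union>i\<in>{1..m}. \<Union>I\<in>{I\<in>ifs_words m. length I = n}. Phi f (I @ [i]) ` A)"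
      by (fastforce simp: ifs_words_def)
  next
    fix y assume "y \<in> (\<Union>i\<in>{1..m}. \<Union>I\<in>{I\<in>ifs_words m. length I = n}. Phi f (I @ [i]) ` A)"
    then obtain i I where I: "i \<in> {1..m}" "I \<in> ifs_words m" "length I = n" "y \<in> Phi f (I @ [i]) ` A"
      by blast
    then have "I @ [i] \<in> {J \<in> ifs_words m. length J = Suc n}"
      by (simp add: ifs_words_def)
    with I(4) show "y \<in> (\<Union>J\<in>{J\<in>ifs_words m. length J = Suc n}. Phi f J ` A)"
      by blast
  qed
  finally show ?case .
qed

lemma Phi_mem_Hutch_iterate:
  assumes "forward_invariant m f A" "I \<in> ifs_words m" "n \<le> length I" "x \<in> A"
  shows "Phi f I x \<in> (Hutch m f ^^ n) A"
proof -
  have "Phi f I x \<in> (Hutch m f ^^ length I) A"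
    using assms unfolding Hutch_iterate_eq by blast
  then show ?thesis
    using decseqD[OF decseq_Hutch_iterate[OF assms(1)] assms(3)] by blast
qed

lemma decseq_compact_Inter_nonempty:
  fixes C :: "nat \<Rightarrow> 'a::t2_space set"
  assumes "decseq C" "\<And>n. compact (C n)" "\<And>n. C n \<noteq> {}"
  shows "(\<Inter>n. C n) \<noteq> {}"
proof -
  have "C 0 \<inter> (\<Inter>n\<in>UNIV. C n) \<noteq> {}"
  proof (rule compact_imp_fip_image)
    fix J :: "nat set" assume "finite J"
    \<comment> \<open>Finitely many members of the chain all contain the one of largest index.
      Inserting 0 brings in \<open>C 0\<close> and keeps \<open>Max\<close> meaningful for empty
      \<open>J\<close>.\<close>
    have "C (Max (insert 0 J)) \<subseteq> C n" if "n \<in> insert 0 J" for n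
      using \<open>finite J\<close> that by (intro decseqD[OF assms(1)] Max_ge) auto
    then have "C (Max (insert 0 J)) \<subseteq> C 0 \<inter> (\<Inter>n\<in>J. C n)"
      by blast
    then show "C 0 \<inter> (\<Inter>n\<in>J. C n) \<noteq> {}"
      using assms(3) by blast
  qed (use assms(2) in \<open>auto intro: compact_imp_closed\<close>)
  then show ?thesis
    by blast
qed

lemma Omega_eq_Inter_Hutch_iterate:
  assumes "ifs m f" "compact Q" "forward_invariant m f Q"
  shows "Omega m f Q = (\<Inter>n. (Hutch m f ^^ n) Q)"
proof (intro equalityI subsetI)
  fix y assume "y \<in> Omega m f Q"
  then obtain I a where I: "\<And>k. I k \<in> ifs_words m" and a: "\<And>k. a k \<in> Q"
    and lim: "filterlim (\<lambda>k. length (I k)) at_top sequentially" "(\<lambda>k. Phi f (I k) (a k)) \<longlonglongrightarrow> y"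
    unfolding Omega_def by blast
  \<comment> \<open>As the word lengths tend to infinity, all but finitely many terms lie in the
    n-th iterate; this is closed, so it contains the limit.\<close>
  have "y \<in> (Hutch m f ^^ n) Q" for n
  proof (rule Lim_in_closed_set[OF _ _ _ lim(2)])
    show "closed ((Hutch m f ^^ n) Q)"
      using assms by (intro compact_imp_closed compact_Hutch_iterate)
    have "\<forall>\<^sub>F k in sequentially. n \<le> length (I k)"
      using lim(1) by (simp add: filterlim_at_top)
    then show "\<forall>\<^sub>F k in sequentially. Phi f (I k) (a k) \<in> (Hutch m f ^^ n) Q"
      by eventually_elim (intro Phi_mem_Hutch_iterate assms I a)
  qed simp
  then show "y \<in> (\<Inter>n. (Hutch m f ^^ n) Q)"
    by blast
next
  fix y assume y: "y \<in> (\<Inter>n. (Hutch m f ^^ n) Q)"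
  \<comment> \<open>Here \<open>y\<close> is attained exactly by a word of each length n, so the
    sequence witnessing membership in \<open>Omega\<close> is constantly \<open>y\<close>.\<close>
  have "\<exists>I a. I \<in> ifs_words m \<and> length I = n \<and> a \<in> Q \<and> y = Phi f I a" for n
  proof -
    have "y \<in> (Hutch m f ^^ n) Q"
      using y by blast
    then show ?thesis
      unfolding Hutch_iterate_eq by blast
  qed
  then obtain I a where "\<And>n. I n \<in> ifs_words m" "\<And>n. length (I n) = n"
    "\<And>n. a n \<in> Q" "\<And>n. y = Phi f (I n) (a n)"
    by metis
  then show "y \<in> Omega m f Q"
    unfolding Omega_def mem_Collect_eq
    by (intro exI[of _ I] exI[of _ a]) (auto simp flip: \<open>\<And>n. y = _ n\<close> intro: filterlim_ident)
qed

lemma H_invariant_Inter_Hutch_iterate: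
  assumes "ifs m f" "compact Q" "forward_invariant m f Q"
  shows "H_invariant m f (\<Inter>n. (Hutch m f ^^ n) Q)"
  unfolding H_invariant_def
proof (intro equalityI subsetI)
  fix y assume y: "y \<in> Hutch m f (\<Inter>n. (Hutch m f ^^ n) Q)"
  have "y \<in> (Hutch m f ^^ n) Q" for n
  proof -
    have "y \<in> (Hutch m f ^^ Suc n) Q"
      using y Hutch_mono[of "\<Inter>n. (Hutch m f ^^ n) Q" "(Hutch m f ^^ n) Q" m f] by auto
    then show ?thesis
      using decseqD[OF decseq_Hutch_iterate[OF assms(3)], of n "Suc n"] by auto
  qed
  then show "y \<in> (\<Inter>n. (Hutch m f ^^ n) Q)"
    by blast
next
  fix y assume y: "y \<in> (\<Inter>n. (Hutch m f ^^ n) Q)"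
  \<comment> \<open>\<open>P\<close> collects the preimages of \<open>y\<close> under all the maps,
    so a point common to all \<open>C n\<close> is a preimage of \<open>y\<close> inside the
    intersection.\<close>
  define P where "P = (\<Union>i\<in>{1..m}. f i -` {y})"
  define C where "C n = (Hutch m f ^^ n) Q \<inter> P" for n
  have "closed P"
    unfolding P_def using assms(1)
    by (intro closed_UN ballI closed_vimage ifs_continuous_on) auto
  then have "compact (C n)" for n
    unfolding C_def using assms by (intro compact_Int_closed compact_Hutch_iterate)
  moreover have "decseq C"
    using decseq_Hutch_iterate[OF assms(3)] unfolding C_def decseq_def by blast
  moreover have "C n \<noteq> {}" for n
  proof -
    \<comment> \<open>The index shift matters: membership in iterate n + 1 yields a preimage in
      iterate n.\<close>
    have "y \<in> (Hutch m f ^^ Suc n) Q"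
      using y by blast
    then show ?thesis
      by (auto simp: C_def P_def Hutch_def)
  qed
  ultimately have "(\<Inter>n. C n) \<noteq> {}"
    by (intro decseq_compact_Inter_nonempty)
  then show "y \<in> Hutch m f (\<Inter>n. (Hutch m f ^^ n) Q)"
    by (auto simp: C_def P_def Hutch_def)
qed

lemma open_eps_nbhd: "open (eps_nbhd \<epsilon> A)"
proof (cases "A = {}")
  case False
  then have "eps_nbhd \<epsilon> A = {x. infdist x A < \<epsilon>}"
    by (simp add: eps_nbhd_def)
  then show ?thesis
    by (auto intro!: open_Collect_less continuous_intros)
qed (simp add: eps_nbhd_def)

lemma subset_eps_nbhd: "0 < \<epsilon> \<Longrightarrow> A \<subseteq> eps_nbhd \<epsilon> A"
  by (auto simp: eps_nbhd_def)

text \<open>An empty intersection is covered too: its neighbourhood is then empty, and the argument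
  shows that some iterate is already empty.\<close>

lemma Hutch_iterate_subset_eps_nbhd:
  assumes "ifs m f" "compact Q" "forward_invariant m f Q" "0 < \<epsilon>"
  shows "\<exists>n. (Hutch m f ^^ n) Q \<subseteq> eps_nbhd \<epsilon> (\<Inter>n. (Hutch m f ^^ n) Q)"
proof (rule ccontr)
  let ?U = "eps_nbhd \<epsilon> (\<Inter>n. (Hutch m f ^^ n) Q)"
  assume "\<not> ?thesis"
  then have "(Hutch m f ^^ n) Q - ?U \<noteq> {}" for n
    by blast
  moreover have "compact ((Hutch m f ^^ n) Q - ?U)" for n
    using assms by (intro compact_diff compact_Hutch_iterate open_eps_nbhd)
  moreover have "decseq (\<lambda>n. (Hutch m f ^^ n) Q - ?U)"
    using decseq_Hutch_iterate[OF assms(3)] unfolding decseq_def by blast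
  ultimately have "(\<Inter>n. (Hutch m f ^^ n) Q - ?U) \<noteq> {}"
    by (intro decseq_compact_Inter_nonempty)
  then show False
    using subset_eps_nbhd[OF assms(4), of "\<Inter>n. (Hutch m f ^^ n) Q"] by blast
qed

lemma attracts_if_absorbs:
  assumes "ifs m f" "compact Q" "forward_invariant m f Q" "absorbs m f Q K"
  shows "attracts m f (\<Inter>n. (Hutch m f ^^ n) Q) K"
  unfolding attracts_def
proof (intro allI impI)
  fix \<epsilon> :: real assume "\<epsilon> > 0"
  then obtain n where n: "(Hutch m f ^^ n) Q \<subseteq> eps_nbhd \<epsilon> (\<Inter>n. (Hutch m f ^^ n) Q)"
    using Hutch_iterate_subset_eps_nbhd assms by blast
  obtain \<sigma> :: nat where \<sigma>: "\<sigma> > 0"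
    "\<And>I. I \<in> ifs_words m \<Longrightarrow> \<sigma> \<le> length I \<Longrightarrow> Phi f I ` K \<subseteq> Q"
    using assms(4) unfolding absorbs_def by meson
  have "Phi f I ` K \<subseteq> (Hutch m f ^^ n) Q" if I: "I \<in> ifs_words m" "\<sigma> + n \<le> length I" for I
  proof
    fix y assume "y \<in> Phi f I ` K"
    then obtain x where x: "x \<in> K" "y = Phi f I x"
      by blast
    \<comment> \<open>The first \<sigma> letters, which are applied first, move \<open>K\<close>
      into \<open>Q\<close>; the remaining letters, at least n of them, move \<open>Q\<close> into
      the n-th iterate.\<close>
    have words: "take \<sigma> I \<in> ifs_words m" "drop \<sigma> I \<in> ifs_words m"
      using I(1) by (auto simp: ifs_words_def dest: in_set_takeD in_set_dropD)
    have "Phi f (take \<sigma> I) x \<in> Q"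
      using \<sigma>(2)[OF words(1)] I(2) x(1) by auto
    then have "Phi f (drop \<sigma> I) (Phi f (take \<sigma> I) x) \<in> (Hutch m f ^^ n) Q"
      using I(2) by (intro Phi_mem_Hutch_iterate assms words) auto
    then show "y \<in> (Hutch m f ^^ n) Q"
      by (simp add: x(2) flip: Phi_append)
  qed
  with n \<sigma>(1) show "\<exists>\<tau>>0. \<forall>I\<in>ifs_words m. \<tau> \<le> length I \<longrightarrow>
      Phi f I ` K \<subseteq> eps_nbhd \<epsilon> (\<Inter>n. (Hutch m f ^^ n) Q)"
    by (intro exI[of _ "\<sigma> + n"]) auto
qed

theorem theorem1:
  fixes m :: nat and f :: "nat \<Rightarrow> 'a::metric_space \<Rightarrow> 'a" and Q :: "'a set"
  assumes "separable_space (euclidean :: 'a topology)"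
    and "locally_compact_space (euclidean :: 'a topology)"
    and "ifs m f"
    and "compact Q"
    and "global_trapping_region m f Q"
  shows "compact_dynamics m f \<and> global_attractor m f = Omega m f Q"
proof -
  have Q: "forward_invariant m f Q" "\<And>K. compact K \<Longrightarrow> absorbs m f Q K"
    using assms(5) by (auto simp: global_trapping_region_def trapping_region_def)
  have "closed (\<Inter>n. (Hutch m f ^^ n) Q)"
    using assms(3,4) by (intro closed_INT ballI compact_imp_closed compact_Hutch_iterate)
  \<comment> \<open>Intersecting with the compact set \<open>Q\<close> leaves the intersection
    unchanged, because \<open>Q\<close> is its zeroth member.\<close>
  with assms(4) have "compact (Q \<inter> (\<Inter>n. (Hutch m f ^^ n) Q))"
    by (rule compact_Int_closed)
  moreover have "(\<Inter>n. (Hutch m f ^^ n) Q) \<subseteq> Q"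
    by (rule INF_lower2[of 0]) auto
  ultimately have "compact (\<Inter>n. (Hutch m f ^^ n) Q)"
    by (simp add: inf.absorb2)
  then have "is_global_attractor m f (Omega m f Q)"
    unfolding is_global_attractor_def Omega_eq_Inter_Hutch_iterate[OF assms(3,4) Q(1)]
    using H_invariant_Inter_Hutch_iterate attracts_if_absorbs assms(3,4) Q by blast
  then show ?thesis
    unfolding compact_dynamics_def using global_attractor_eqI by blast
qed

end
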